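(* Let $N$ be a basis matrix of $\mathcal{N}$. Let $m_1,\ldots,m_r$ be a basis of $\mathcal{M}$ such that $m_1,m_2,\ldots,m_k$ is a basis of $\mathcal{M}\cap\ker\tilde C$, and let $M=[\,m_{k+1}\ \cdots\ m_r\,]$. The set of matrices $K\in\mathbb{R}^{m\times p}$ such that $(\tilde A+\tilde B\,K\,\tilde C)\,\mathcal{M}\subseteq\mathcal{N}$ is (exhaustively) parameterized in terms of the matrices $H_1$ and $H_2$ (arbitrary, of suitable sizes) as $$K=-R_2\,\tilde A\,M\,(\tilde C\,M)^\dagger-\Phi_2\,H_1\,(\tilde C\,M)^\dagger+H_2\,\Psi,$$ where - $\begin{bmatrix}R_1\\R_2\end{bmatrix}=[\,N\ \ \tilde B\,]^\dagger$, partitioned conformably (so that $R_2$ has $m$ rows); - $\Phi=\begin{bmatrix}\Phi_1\\\Phi_2\end{bmatrix}$ is a basis matrix of $\ker[\,N\ \ \tilde B\,]$, partitioned conformably (so that $\Phi_2$ has $m$ rows); - $\Psi$ is a basis matrix of the left null-space of $\tilde C\,M$, i.e., the rows of $\Psi$ form a basis of that left null-space, so that $\Psi$ is full row-rank and $\Psi\,\tilde C\,M=0$.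
   Context: Here $n_1,n_2,m,p$ are positive integers, $\mathcal{M}$ is a subspace of $\mathbb{R}^{n_2}$, $\mathcal{N}$ is a subspace of $\mathbb{R}^{n_1}$, and $\tilde A\in\mathbb{R}^{n_1\times n_2}$, $\tilde B\in\mathbb{R}^{n_1\times m}$, $\tilde C\in\mathbb{R}^{p\times n_2}$. $X^\dagger$ denotes the Moore–Penrose pseudoinverse of a matrix $X$. A basis matrix of a subspace is a matrix whose columns form a basis of that subspace (for a left null-space, whose rows form a basis).
   Formalization: The formal theorem additionally assumes that at least one K with (A+BKC)M ⊆ N exists; otherwise the claim fails, since the formula always yields some K (e.g. all sizes 1, A=1, B=0, C=1, M=R, N={0}: no K is admissible). *)

theory Defs
  imports "Jordan_Normal_Form.Matrix_Kernel"
begin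

text \<open>
  Matrices are taken from \<open>Jordan_Normal_Form\<close> because the dimensions of several matrices
  depend on the dimensions of subspaces and may be zero.
\<close>

definition is_subspace :: "nat \<Rightarrow> real vec set \<Rightarrow> bool" where
  "is_subspace n W \<longleftrightarrow> VectorSpace.subspace class_ring W (module_vec TYPE(real) n)"

text \<open>
  The list \<open>bs\<close> is an (ordered) basis of the subspace \<open>W\<close> of dimension-\<open>n\<close> vectors;
  linear independence and span refer to \<open>W\<close> regarded as a vector space of its own.
\<close>

definition is_basis_list :: "nat \<Rightarrow> real vec set \<Rightarrow> real vec list \<Rightarrow> bool" where
  "is_basis_list n W bs \<longleftrightarrow>
     distinct bs \<and>
     vectorspace.basis class_ring ((module_vec TYPE(real) n)\<lparr>carrier := W\<rparr>) (set bs)"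

definition is_basis_matrix :: "nat \<Rightarrow> real vec set \<Rightarrow> real mat \<Rightarrow> bool" where
  "is_basis_matrix n W X \<longleftrightarrow> dim_row X = n \<and> is_basis_list n W (cols X)"

definition left_null_space :: "real mat \<Rightarrow> real vec set" where
  "left_null_space X = mat_kernel (transpose_mat X)"

definition is_left_null_basis_matrix :: "real mat \<Rightarrow> real mat \<Rightarrow> bool" where
  "is_left_null_basis_matrix X Y \<longleftrightarrow>
     dim_col Y = dim_row X \<and> is_basis_list (dim_row X) (left_null_space X) (rows Y)"

definition append_cols :: "real mat \<Rightarrow> real mat \<Rightarrow> real mat" (infixr \<open>@\<^sub>c\<close> 65) where
  "X @\<^sub>c Y = four_block_mat X Y (0\<^sub>m 0 (dim_col X)) (0\<^sub>m 0 (dim_col Y))"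

definition is_moore_penrose :: "real mat \<Rightarrow> real mat \<Rightarrow> bool" where
  "is_moore_penrose X Y \<longleftrightarrow>
     Y \<in> carrier_mat (dim_col X) (dim_row X) \<and>
     X * Y * X = X \<and> Y * X * Y = Y \<and>
     transpose_mat (X * Y) = X * Y \<and> transpose_mat (Y * X) = Y * X"

definition pinv :: "real mat \<Rightarrow> real mat" where
  "pinv X = (THE Y. is_moore_penrose X Y)"

end

theory Submission
  imports Defs "Jordan_Normal_Form.DL_Rank"
begin

text \<open>
  Writing \<open>T = - K C M\<close>, the condition on \<open>K\<close> splits along the basis of \<open>\<M>\<close>: on
  \<open>\<M> \<inter> ker C\<close> it does not involve \<open>K\<close> and holds by solvability, while on the remaining basis
  vectors it says that \<open>[N B] [L; T] = A M\<close> for some \<open>L\<close>. The solutions of this consistent system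
  are \<open>[N B]\<^sup>\<dagger> A M + \<Phi> H\<^sub>1\<close>, whose lower block is \<open>T = R\<^sub>2 A M + \<Phi>\<^sub>2 H\<^sub>1\<close>. Since the omitted basis
  vectors span \<open>\<M> \<inter> ker C\<close>, the matrix \<open>C M\<close> has full column rank, so \<open>(C M)\<^sup>\<dagger>\<close> is a left
  inverse and \<open>K C M = - T\<close> has exactly the solutions \<open>K = - T (C M)\<^sup>\<dagger> + H\<^sub>2 \<Psi>\<close>.
\<close>

section \<open>Moore--Penrose pseudoinverses\<close>

text \<open>Every pivot column is a unit vector, so \<open>E * Q\<close> is the diagonal projection
  \<open>D\<close> onto the nonzero rows of \<open>E\<close>. Only zero rows are discarded by
  \<open>D\<close>, hence \<open>D * E = E\<close>.\<close>

lemma row_echelon_generalized_inverse: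
  fixes E :: "'a :: field mat"
  assumes E: "E \<in> carrier_mat nr nc" and "row_echelon_form E"
  obtains Q where "Q \<in> carrier_mat nc nr" "E * Q * E = E"
proof -
  obtain f where "pivot_fun E f nc"
    using assms unfolding row_echelon_form_def by auto
  note piv = pivot_funD[OF carrier_matD(1)[OF E] this]
  \<comment> \<open>\<open>Q\<close> sends the \<open>i\<close>-th unit vector to the unit vector of the \<open>i\<close>-th pivot column; a zero row has
    \<open>f i = nc\<close>, which is out of range.\<close>
  define Q :: "'a mat" where "Q = mat nc nr (\<lambda>(a, i). if a = f i then 1 else 0)"
  define D :: "'a mat" where "D = mat nr nr (\<lambda>(i, j). if i = j \<and> f i < nc then 1 else 0)"
  have Q: "Q \<in> carrier_mat nc nr" and D: "D \<in> carrier_mat nr nr"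
    unfolding Q_def D_def by auto
  have EQ: "E * Q = D"
  proof (rule eq_matI)
    fix i j assume "i < dim_row D" "j < dim_col D"
    hence ij: "i < nr" "j < nr" using D by auto
    have "(E * Q) $$ (i, j) = (\<Sum>a = 0..<nc. E $$ (i, a) * (if a = f j then 1 else 0))"
      using ij E by (simp add: Q_def scalar_prod_def)
    also have "\<dots> = (if f j < nc then E $$ (i, f j) else 0)"
      by (simp add: if_distrib[of "\<lambda>x. _ * x"] sum.delta cong: if_cong)
    also have "\<dots> = D $$ (i, j)"
      using ij piv(4)[of j] piv(5)[of j i] by (auto simp: D_def)
    finally show "(E * Q) $$ (i, j) = D $$ (i, j)" .
  qed (insert E Q D, auto)
  have "D * E = E"
  proof (rule eq_matI)
    fix i j assume "i < dim_row E" "j < dim_col E"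
    hence ij: "i < nr" "j < nc" using E by auto
    have "(D * E) $$ (i, j) = (\<Sum>a = 0..<nr. (if i = a \<and> f i < nc then 1 else 0) * E $$ (a, j))"
      using ij E by (simp add: D_def scalar_prod_def)
    also have "\<dots> = (\<Sum>a = 0..<nr. if a = i then (if f i < nc then 1 else 0) * E $$ (i, j) else 0)"
      by (rule sum.cong) auto
    also have "\<dots> = (if f i < nc then 1 else 0) * E $$ (i, j)"
      using ij by simp
    also have "\<dots> = E $$ (i, j)"
      using ij piv(1)[of i] piv(2)[of i j] by auto
    finally show "(D * E) $$ (i, j) = E $$ (i, j)" .
  qed (insert E D, auto)
  with EQ Q show thesis using that by simp
qed

text \<open>Gauss-Jordan elimination gives \<open>E = P * X\<close> with \<open>P\<close>
  invertible, so a generalized inverse \<open>Q\<close> of the echelon form \<open>E\<close> turns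
  into the generalized inverse \<open>Q * P\<close> of \<open>X\<close>.\<close>

lemma generalized_inverse_exists:
  fixes X :: "'a :: field mat"
  assumes X: "X \<in> carrier_mat nr nc"
  obtains Y where "Y \<in> carrier_mat nc nr" "X * Y * X = X"
proof -
  define E where "E = gauss_jordan_single X"
  note gj = gauss_jordan_single[OF X E_def[symmetric]]
  note E = gj(2)
  obtain P P' where EP: "E = P * X" and P: "P \<in> carrier_mat nr nr"
    and P': "P' \<in> carrier_mat nr nr" and inv: "P' * P = 1\<^sub>m nr"
    using gj(4) by blast
  obtain Q where Q: "Q \<in> carrier_mat nc nr" and EQE: "E * Q * E = E"
    using row_echelon_generalized_inverse[OF gj(2,3)] .
  have XE: "X = P' * E"
    unfolding EP using X P P' inv by (simp add: assoc_mult_mat[of _ nr nr _ nr _ nc, symmetric])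
  have QP: "Q * P \<in> carrier_mat nc nr" and QE: "Q * E \<in> carrier_mat nc nc" using Q P E by auto
  have "X * (Q * P) * X = X * (Q * E)"
    unfolding assoc_mult_mat[OF X QP X] assoc_mult_mat[OF Q P X] EP ..
  also have "\<dots> = P' * E * (Q * E)" using XE by simp
  also have "\<dots> = P' * (E * Q * E)"
    unfolding assoc_mult_mat[OF P' E QE] assoc_mult_mat[OF E Q E] ..
  finally have "X * (Q * P) * X = X" using EQE XE by simp
  thus thesis using that QP by blast
qed

section \<open>Additive rearrangement of matrix equations\<close>

lemma minus_mat_eqD:
  fixes X Y :: "'a :: ab_group_add mat"
  assumes X: "X \<in> carrier_mat nr nc" and Y: "Y \<in> carrier_mat nr nc" and Z: "X - Y = Z"
  shows "X = Y + Z"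
  unfolding Z[symmetric] using X Y by (intro eq_matI) auto

lemma add_eq_iff_mat:
  fixes X Y Z :: "'a :: ab_group_add mat"
  assumes "X \<in> carrier_mat nr nc" "Y \<in> carrier_mat nr nc" "Z \<in> carrier_mat nr nc"
  shows "X + Y = Z \<longleftrightarrow> Z + - Y = X"
proof
  show "Z + - Y = X" if "X + Y = Z"
    unfolding that[symmetric] using assms by (intro eq_matI) auto
  show "X + Y = Z" if "Z + - Y = X"
    unfolding that[symmetric] using assms by (intro eq_matI) auto
qed

lemma uminus_add_mat:
  fixes X Y :: "'a :: ab_group_add mat"
  assumes "X \<in> carrier_mat nr nc" "Y \<in> carrier_mat nr nc"
  shows "- (X + Y) = - X - Y"
  using assms by (intro eq_matI) auto

text \<open>The diagonal entry \<open>j\<close> of the Gram matrix is the sum of squares of column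
  \<open>j\<close>. Over the reals such a sum vanishes only if every term does.\<close>

lemma transpose_mult_self_eq_0:
  fixes Z :: "real mat"
  assumes Z: "Z \<in> carrier_mat nr nc" and 0: "transpose_mat Z * Z = 0\<^sub>m nc nc"
  shows "Z = 0\<^sub>m nr nc"
proof (rule eq_matI)
  fix i j assume "i < dim_row (0\<^sub>m nr nc :: real mat)" "j < dim_col (0\<^sub>m nr nc :: real mat)"
  hence ij: "i < nr" "j < nc" by auto
  have "(\<Sum>a = 0..<nr. Z $$ (a, j) * Z $$ (a, j)) = (transpose_mat Z * Z) $$ (j, j)"
    using ij Z by (simp add: scalar_prod_def)
  also have "\<dots> = 0" using 0 ij by simp
  finally have "\<forall>a \<in> {0..<nr}. Z $$ (a, j) * Z $$ (a, j) = 0"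
    by (subst (asm) sum_nonneg_eq_0_iff) auto
  thus "Z $$ (i, j) = 0\<^sub>m nr nc $$ (i, j)" using ij by auto
qed (insert Z, auto)

text \<open>For \<open>W = U - V\<close> the hypothesis makes the Gram matrix of
  \<open>X * W\<close> vanish, so \<open>X * W = 0\<close>. This allows a leading transpose to be
  cancelled in normal equations.\<close>

lemma transpose_mult_self_cancel:
  fixes X U V :: "real mat"
  assumes X: "X \<in> carrier_mat nr nc" and U: "U \<in> carrier_mat nc k" and V: "V \<in> carrier_mat nc k"
    and eq: "transpose_mat X * X * U = transpose_mat X * X * V"
  shows "X * U = X * V"
proof -
  let ?W = "U - V"
  have W: "?W \<in> carrier_mat nc k" and XW: "X * ?W \<in> carrier_mat nr k"
    and Xt: "transpose_mat X \<in> carrier_mat nc nr" and Wt: "transpose_mat ?W \<in> carrier_mat k nc"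
    using X U V by auto
  have XX: "transpose_mat X * X \<in> carrier_mat nc nc" using X by auto
  have "transpose_mat (X * ?W) * (X * ?W) = transpose_mat ?W * (transpose_mat X * (X * ?W))"
    using X W XW Xt Wt by (simp add: transpose_mult[of X nr nc] assoc_mult_mat[OF Wt Xt XW])
  also have "transpose_mat X * (X * ?W) = transpose_mat X * X * ?W"
    using assoc_mult_mat[OF Xt X W] by simp
  also have "\<dots> = 0\<^sub>m nc k"
    using mult_minus_distrib_mat[OF XX U V] eq XX V by simp
  also have "transpose_mat ?W * 0\<^sub>m nc k = 0\<^sub>m k k"
    by (rule right_mult_zero_mat[OF Wt])
  finally have "X * ?W = 0\<^sub>m nr k" using transpose_mult_self_eq_0[OF XW] by simp
  hence "X * U - X * V = 0\<^sub>m nr k" using mult_minus_distrib_mat[OF X U V] by simp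
  hence "X * U = X * V + 0\<^sub>m nr k"
    by (rule minus_mat_eqD[rotated 2]) (use X U V in auto)
  thus ?thesis using X V by simp
qed

lemma least_squares_inverse_exists:
  fixes X :: "real mat"
  assumes X: "X \<in> carrier_mat nr nc"
  obtains Y where "Y \<in> carrier_mat nc nr" "X * Y * X = X" "transpose_mat (X * Y) = X * Y"
proof -
  let ?T = "transpose_mat X"
  have T: "?T \<in> carrier_mat nc nr" using X by simp
  have S: "?T * X \<in> carrier_mat nc nc" using T X by simp
  obtain G where G: "G \<in> carrier_mat nc nc" and SGS: "?T * X * G * (?T * X) = ?T * X"
    using generalized_inverse_exists[OF S] .
  let ?Y = "G * ?T"
  have Y: "?Y \<in> carrier_mat nc nr" using G T by simp
  have XY: "X * ?Y \<in> carrier_mat nr nr" using X Y by simp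
  have YX: "?Y * X \<in> carrier_mat nc nc" using X Y by simp
  \<comment> \<open>Since \<open>?Y = G * ?T\<close>, this is the generalized inverse property of
    \<open>G\<close> in another bracketing; the factor \<open>?T\<close> is then cancelled.\<close>
  have "?T * X * (?Y * X) = ?T * X * 1\<^sub>m nc"
    using SGS unfolding assoc_mult_mat[OF G T X] assoc_mult_mat[OF S G S] right_mult_one_mat[OF S] .
  hence "X * (?Y * X) = X * 1\<^sub>m nc"
    by (rule transpose_mult_self_cancel[OF X YX one_carrier_mat])
  hence XYX: "X * ?Y * X = X" using X by (simp add: assoc_mult_mat[OF X Y X])
  let ?P = "X * ?Y"
  have Pt: "transpose_mat ?P \<in> carrier_mat nr nr" using XY by simp
  \<comment> \<open>Transposing \<open>?P * X = X\<close> gives this. As \<open>?P\<close> ends in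
    the factor \<open>?T\<close>, it follows that \<open>?P\<close> equals
    \<open>?P * transpose_mat ?P\<close>, which is visibly symmetric.\<close>
  have "?T * transpose_mat ?P = ?T"
    using transpose_mult[OF XY X] XYX by simp
  hence "?P * transpose_mat ?P = ?P"
    unfolding assoc_mult_mat[OF X Y Pt] assoc_mult_mat[OF G T Pt] by simp
  moreover have "transpose_mat (?P * transpose_mat ?P) = ?P * transpose_mat ?P"
    using transpose_mult[OF XY Pt] by simp
  ultimately have "transpose_mat ?P = ?P" by simp
  thus thesis using that Y XYX by blast
qed

text \<open>Urquhart's formula: let \<open>Y\<close> and \<open>Z\<close> be generalized inverses of
  \<open>X\<close> with \<open>X * Y\<close> and \<open>Z * X\<close> symmetric. Then
  \<open>Z * X * Y\<close> satisfies all four Penrose equations, because multiplying it by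
  \<open>X\<close> gives \<open>X * Y\<close> on one side and \<open>Z * X\<close> on the other.
  Such a \<open>Z\<close> comes from the least-squares inverse of the transpose.\<close>

lemma moore_penrose_exists: "\<exists>Y. is_moore_penrose X Y"
proof -
  define nr nc where "nr = dim_row X" and "nc = dim_col X"
  have X: "X \<in> carrier_mat nr nc" unfolding nr_def nc_def by simp
  have T: "transpose_mat X \<in> carrier_mat nc nr" using X by simp
  obtain Y where Y: "Y \<in> carrier_mat nc nr" and XYX: "X * Y * X = X"
    and XYt: "transpose_mat (X * Y) = X * Y"
    using least_squares_inverse_exists[OF X] .
  obtain Z' where Z': "Z' \<in> carrier_mat nr nc"
    and TZT: "transpose_mat X * Z' * transpose_mat X = transpose_mat X"
    and TZt: "transpose_mat (transpose_mat X * Z') = transpose_mat X * Z'"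
    using least_squares_inverse_exists[OF T] .
  define Z where "Z = transpose_mat Z'"
  have Z: "Z \<in> carrier_mat nc nr" unfolding Z_def using Z' by simp
  have ZXt': "transpose_mat (Z * X) = transpose_mat X * Z'"
    using transpose_mult[OF Z X] by (simp add: Z_def)
  hence ZXt: "transpose_mat (Z * X) = Z * X"
    using TZt by (metis transpose_transpose)
  have ZX: "Z * X \<in> carrier_mat nc nc" and XY: "X * Y \<in> carrier_mat nr nr"
    and ZXY: "Z * X * Y \<in> carrier_mat nc nr" using X Y Z by auto
  have "transpose_mat (X * (Z * X)) = transpose_mat X"
    using transpose_mult[OF X ZX] ZXt' TZT by simp
  hence XZX: "X * (Z * X) = X" by (metis transpose_transpose)
  have 1: "X * (Z * X * Y) = X * Y"
    using XZX assoc_mult_mat[OF X ZX Y] by simp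
  have 2: "Z * X * Y * X = Z * X"
    using XYX unfolding assoc_mult_mat[OF Z X Y] assoc_mult_mat[OF Z XY X] by simp
  have 3: "Z * X * (Z * X * Y) = Z * X * Y"
    using assoc_mult_mat[OF Z X ZXY] assoc_mult_mat[OF Z X Y] 1 by simp
  show ?thesis
    unfolding is_moore_penrose_def
  proof (intro exI[of _ "Z * X * Y"] conjI)
    show "Z * X * Y \<in> carrier_mat (dim_col X) (dim_row X)"
      using ZXY unfolding nr_def nc_def .
  qed (use 1 2 3 XYX XYt ZXt in simp_all)
qed

text \<open>The projections \<open>X * Y\<close> and \<open>X * Z\<close> are symmetric with the
  same range, hence equal; likewise \<open>Y * X = Z * X\<close>. Then
  \<open>Y = Y * X * Y = Y * X * Z = Z * X * Z = Z\<close>.\<close>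

lemma moore_penrose_unique:
  assumes "is_moore_penrose X Y" and "is_moore_penrose X Z"
  shows "Y = Z"
proof -
  define nr nc where "nr = dim_row X" and "nc = dim_col X"
  have X: "X \<in> carrier_mat nr nc" unfolding nr_def nc_def by simp
  note mp = assms[unfolded is_moore_penrose_def, folded nr_def nc_def]
  from mp have Y: "Y \<in> carrier_mat nc nr" and Z: "Z \<in> carrier_mat nc nr" by auto
  have XY: "X * Y \<in> carrier_mat nr nr" and XZ: "X * Z \<in> carrier_mat nr nr"
    and YX: "Y * X \<in> carrier_mat nc nc" and ZX: "Z * X \<in> carrier_mat nc nc"
    using X Y Z by auto
  have "X * Y * (X * Z) = X * Z"
    using mp unfolding assoc_mult_mat[OF XY X Z, symmetric] by simp
  \<comment> \<open>By symmetry of both factors, transposition reverses their order, and the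
    reversed product collapses to \<open>X * Y\<close> through \<open>X * Z * X = X\<close>.\<close>
  hence "transpose_mat (X * Y * (X * Z)) = X * Z" using mp by simp
  hence "X * Z * (X * Y) = X * Z"
    using transpose_mult[OF XY XZ] mp by simp
  hence XYZ: "X * Z = X * Y"
    using mp unfolding assoc_mult_mat[OF XZ X Y, symmetric] by simp
  have "Y * X * (Z * X) = Y * X"
    using mp unfolding assoc_mult_mat[OF Y X ZX] assoc_mult_mat[OF X Z X] by simp
  hence "transpose_mat (Y * X * (Z * X)) = Y * X" using mp by simp
  hence "Z * X * (Y * X) = Y * X"
    using transpose_mult[OF YX ZX] mp by simp
  hence YZX: "Z * X = Y * X"
    using mp unfolding assoc_mult_mat[OF Z X YX] assoc_mult_mat[OF X Y X] by simp
  have "Y = Y * X * Y" using mp by simp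
  also have "\<dots> = Y * X * Z" unfolding assoc_mult_mat[OF Y X Y] assoc_mult_mat[OF Y X Z] XYZ ..
  also have "\<dots> = Z" unfolding YZX[symmetric] using mp by simp
  finally show ?thesis .
qed

lemma is_moore_penrose_pinv: "is_moore_penrose X (pinv X)"
  unfolding pinv_def by (rule theI') (use moore_penrose_exists moore_penrose_unique in blast)

lemma pinv_carrier: "X \<in> carrier_mat nr nc \<Longrightarrow> pinv X \<in> carrier_mat nc nr"
  using is_moore_penrose_pinv[of X] unfolding is_moore_penrose_def by auto

lemma mult_pinv_mult: "X * pinv X * X = X"
  using is_moore_penrose_pinv[of X] unfolding is_moore_penrose_def by auto

section \<open>Subspaces and basis matrices\<close>

lemma subspace_carrier: "is_subspace n W \<Longrightarrow> W \<subseteq> carrier_vec n"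
  unfolding is_subspace_def subspace_def submodule_def by (simp add: module_vec_simps)

lemma is_subspaceI:
  assumes "W \<subseteq> carrier_vec n" "0\<^sub>v n \<in> W" "\<And>v w. v \<in> W \<Longrightarrow> w \<in> W \<Longrightarrow> v + w \<in> W"
    "\<And>c v. v \<in> W \<Longrightarrow> c \<cdot>\<^sub>v v \<in> W"
  shows "is_subspace n W"
  unfolding is_subspace_def subspace_def submodule_def
  using assms vec_vs[of n] vec_module[of n] by (auto simp: module_vec_simps)

lemma is_subspaceD:
  assumes "is_subspace n W"
  shows "0\<^sub>v n \<in> W" "v \<in> W \<Longrightarrow> w \<in> W \<Longrightarrow> v + w \<in> W" "v \<in> W \<Longrightarrow> c \<cdot>\<^sub>v v \<in> W"
  using assms unfolding is_subspace_def subspace_def submodule_def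
  by (auto simp: module_vec_simps)

lemma is_subspace_mat_kernel:
  assumes A: "A \<in> carrier_mat nr n"
  shows "is_subspace n (mat_kernel A)"
  by (rule is_subspaceI)
    (use A in \<open>auto simp: mat_kernel[OF A] mult_add_distrib_mat_vec[OF A] mult_mat_vec[OF A]\<close>)

lemma is_subspace_Int: "is_subspace n V \<Longrightarrow> is_subspace n W \<Longrightarrow> is_subspace n (V \<inter> W)"
  by (rule is_subspaceI) (auto dest: subspace_carrier is_subspaceD)

text \<open>A basis is defined inside \<open>W\<close> as a vector space of its own; span and
  independence of subsets of a submodule agree with those in the ambient space, where the results
  about matrices apply.\<close>

lemma basis_list_iff:
  assumes "is_subspace n W"
  shows "is_basis_list n W bs \<longleftrightarrow> distinct bs \<and> set bs \<subseteq> W \<and>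
    LinearCombinations.module.span class_ring (module_vec TYPE(real) n) (set bs) = W \<and>
    \<not> LinearCombinations.module.lin_dep class_ring (module_vec TYPE(real) n) (set bs)"
proof -
  interpret vec_space "TYPE(real)" n .
  have sub: "VectorSpace.subspace class_ring W V" using assms unfolding is_subspace_def .
  hence sm: "submodule class_ring W V" unfolding subspace_def by simp
  interpret W: vectorspace class_ring "vs W" using subspace_is_vs[OF sub] .
  show ?thesis
    unfolding is_basis_list_def W.basis_def
    using span_li_not_depend[OF _ sm, of "set bs"] by auto
qed

text \<open>A linear combination of a list is the product of its column matrix with the coefficient
  vector, so the span becomes a column range.\<close>

lemma basis_list_range:
  assumes W: "is_subspace n W" and bs: "is_basis_list n W bs"
  shows "W = {mat_of_cols n bs *\<^sub>v c | c. c \<in> carrier_vec (length bs)}"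
proof -
  interpret vec_space "TYPE(real)" n .
  note b = bs[unfolded basis_list_iff[OF W]]
  have bc: "set bs \<subseteq> carrier_vec n" using b subspace_carrier[OF W] by auto
  hence dim: "\<forall>w \<in> set bs. dim_vec w = n" by auto
  have "W = span_list bs" using b span_list_as_span[OF bc] by simp
  also have "\<dots> = {mat_of_cols n bs *\<^sub>v c | c. c \<in> carrier_vec (length bs)}"
  proof (intro Set.set_eqI iffI)
    fix v assume "v \<in> span_list bs"
    then obtain f where "v = lincomb_list f bs" unfolding span_list_def by auto
    hence "v = mat_of_cols n bs *\<^sub>v vec (length bs) f"
      using lincomb_list_as_mat_mult[OF dim] by simp
    thus "v \<in> {mat_of_cols n bs *\<^sub>v c | c. c \<in> carrier_vec (length bs)}" by auto
  next
    fix v assume "v \<in> {mat_of_cols n bs *\<^sub>v c | c. c \<in> carrier_vec (length bs)}"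
    then obtain c where v: "v = mat_of_cols n bs *\<^sub>v c" and c: "c \<in> carrier_vec (length bs)"
      by auto
    have "vec (length bs) (($) c) = c" using c by auto
    hence "v = lincomb_list (($) c) bs"
      using lincomb_list_as_mat_mult[OF dim] v by simp
    thus "v \<in> span_list bs" unfolding span_list_def by auto
  qed
  finally show ?thesis .
qed

text \<open>A nonzero \<open>c\<close> would be a linear dependence among the distinct
  columns.\<close>

lemma basis_list_independent:
  assumes W: "is_subspace n W" and bs: "is_basis_list n W bs"
    and c: "c \<in> carrier_vec (length bs)" and 0: "mat_of_cols n bs *\<^sub>v c = 0\<^sub>v n"
  shows "c = 0\<^sub>v (length bs)"
proof -
  interpret vec_space "TYPE(real)" n .
  note b = bs[unfolded basis_list_iff[OF W]]
  have bc: "set bs \<subseteq> carrier_vec n" using b subspace_carrier[OF W] by auto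
  have cols: "cols (mat_of_cols n bs) = bs" using bc by (rule cols_mat_of_cols)
  show ?thesis
    using lin_depI[OF mat_of_cols_carrier(1) c _ 0] b unfolding cols by blast
qed

lemma basis_matrix_range:
  assumes "is_subspace n W" and "is_basis_matrix n W X"
  shows "W = {X *\<^sub>v c | c. c \<in> carrier_vec (dim_col X)}"
proof -
  have n: "dim_row X = n" using assms unfolding is_basis_matrix_def by simp
  have "mat_of_cols n (cols X) = X" using mat_of_cols_cols[of X] n by simp
  thus ?thesis
    using basis_list_range[OF assms(1), of "cols X"] assms(2) unfolding is_basis_matrix_def by simp
qed

text \<open>The chosen coefficient vectors of the columns of \<open>Z\<close> are the columns of
  \<open>H\<close>. This turns columnwise membership in a range into one matrix equation.\<close>

lemma factor_through_range:
  fixes X :: "'a :: comm_ring_1 mat"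
  assumes X: "X \<in> carrier_mat n q" and Z: "Z \<in> carrier_mat n s"
    and range: "\<And>j. j < s \<Longrightarrow> \<exists>c \<in> carrier_vec q. col Z j = X *\<^sub>v c"
  obtains H where "H \<in> carrier_mat q s" "Z = X * H"
proof -
  obtain c where c: "\<And>j. j < s \<Longrightarrow> c j \<in> carrier_vec q \<and> col Z j = X *\<^sub>v c j"
    using range by metis
  define H where "H = mat_of_cols q (map c [0..<s])"
  have H: "H \<in> carrier_mat q s" unfolding H_def by auto
  have "col (X * H) j = col Z j" if "j < s" for j
    using c[OF that] that unfolding col_mult2[OF X H that] by (simp add: H_def)
  hence "X * H = Z"
    using X Z H by (intro mat_col_eqI) auto
  thus thesis using that H by blast
qed

section \<open>Arithmetic of stacked block matrices\<close>

lemma append_cols_carrier: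
  "X \<in> carrier_mat nr nc1 \<Longrightarrow> Y \<in> carrier_mat nr nc2 \<Longrightarrow> X @\<^sub>c Y \<in> carrier_mat nr (nc1 + nc2)"
  unfolding append_cols_def by auto

lemma append_rows_mult:
  assumes X: "X \<in> carrier_mat nr1 n" and Y: "Y \<in> carrier_mat nr2 n" and Z: "Z \<in> carrier_mat n nc"
  shows "(X @\<^sub>r Y) * Z = X * Z @\<^sub>r Y * Z"
proof -
  \<comment> \<open>Stacking is a four-block matrix with right-hand blocks of width zero, so
    \<open>Z\<close> is padded by empty blocks to fit the block product rule.\<close>
  have Zb: "four_block_mat Z (0\<^sub>m n 0) (0\<^sub>m 0 nc) (0\<^sub>m 0 0) = Z"
    using Z by (intro eq_matI) auto
  have "(X @\<^sub>r Y) * four_block_mat Z (0\<^sub>m n 0) (0\<^sub>m 0 nc) (0\<^sub>m 0 0) = X * Z @\<^sub>r Y * Z"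
    unfolding append_rows_def using X Y Z
    by (subst mult_four_block_mat[of _ nr1 n _ 0 _ nr2 _ _ nc _ 0]) auto
  thus ?thesis unfolding Zb .
qed

lemma append_cols_mult_append_rows:
  assumes X: "X \<in> carrier_mat nr n1" and Y: "Y \<in> carrier_mat nr n2"
    and U: "U \<in> carrier_mat n1 nc" and V: "V \<in> carrier_mat n2 nc"
  shows "(X @\<^sub>c Y) * (U @\<^sub>r V) = X * U + Y * V"
proof -
  have "(X @\<^sub>c Y) * (U @\<^sub>r V)
    = four_block_mat (X * U + Y * V) (0\<^sub>m nr 0) (0\<^sub>m 0 nc) (0\<^sub>m 0 0)"
    unfolding append_rows_def append_cols_def using X Y U V
    by (subst mult_four_block_mat[of _ nr n1 _ n2 _ 0 _ _ nc _ 0]) auto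
  also have "\<dots> = X * U + Y * V" using X Y U V by (intro eq_matI) auto
  finally show ?thesis .
qed

lemma append_rows_add:
  assumes "X \<in> carrier_mat nr1 nc" "Y \<in> carrier_mat nr2 nc"
    "U \<in> carrier_mat nr1 nc" "V \<in> carrier_mat nr2 nc"
  shows "(X @\<^sub>r Y) + (U @\<^sub>r V) = (X + U) @\<^sub>r (Y + V)"
  unfolding append_rows_def using assms
  by (subst add_four_block_mat[of _ nr1 nc _ 0 _ nr2]) auto

lemma append_rows_eqD:
  assumes "X \<in> carrier_mat nr1 nc" "Y \<in> carrier_mat nr2 nc"
    "U \<in> carrier_mat nr1 nc" "V \<in> carrier_mat nr2 nc" "X @\<^sub>r Y = U @\<^sub>r V"
  shows "X = U" "Y = V"
proof -
  have *: "i < nr1 + nr2 \<Longrightarrow> j < nc \<Longrightarrow> (X @\<^sub>r Y) $$ (i, j) = (U @\<^sub>r V) $$ (i, j)" for i j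
    using assms(5) by simp
  show "X = U"
  proof (rule eq_matI)
    fix i j assume "i < dim_row U" "j < dim_col U"
    thus "X $$ (i, j) = U $$ (i, j)" using *[of i j] assms(1-4) by (simp add: append_rows_def)
  qed (use assms(1-4) in auto)
  show "Y = V"
  proof (rule eq_matI)
    fix i j assume "i < dim_row V" "j < dim_col V"
    thus "Y $$ (i, j) = V $$ (i, j)"
      using *[of "nr1 + i" j] assms(1-4) by (simp add: append_rows_def)
  qed (use assms(1-4) in auto)
qed

section \<open>Linear matrix equations\<close>

text \<open>If the system is consistent, the pseudoinverse gives a particular solution, as
  \<open>Q * pinv Q\<close> fixes everything of the form \<open>Q * Y\<close>.\<close>

lemma mult_pinv_solution:
  assumes Q: "Q \<in> carrier_mat n q" and Y: "Y \<in> carrier_mat q s" and G: "Q * Y = G"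
  shows "Q * (pinv Q * G) = G"
proof -
  have P: "pinv Q \<in> carrier_mat q n" using pinv_carrier[OF Q] .
  have Gc: "G \<in> carrier_mat n s" using Q Y G by auto
  have QP: "Q * pinv Q \<in> carrier_mat n n" using Q P by simp
  have "Q * (pinv Q * G) = Q * pinv Q * Q * Y"
    unfolding assoc_mult_mat[OF Q P Gc, symmetric] assoc_mult_mat[OF QP Q Y] G ..
  thus ?thesis unfolding mult_pinv_mult G .
qed

text \<open>Two solutions differ by a matrix whose columns lie in the kernel, and such a matrix
  factors through \<Phi>. Writing the right-hand side as \<open>Q * Y0\<close> builds in
  consistency.\<close>

lemma linear_system_solutions:
  assumes Q: "Q \<in> carrier_mat n q" and Y0: "Y0 \<in> carrier_mat q s"
    and \<Phi>: "is_basis_matrix q (mat_kernel Q) \<Phi>" and \<Phi>c: "\<Phi> \<in> carrier_mat q d"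
  shows "{Y \<in> carrier_mat q s. Q * Y = Q * Y0} = {Y0 + \<Phi> * H | H. H \<in> carrier_mat d s}"
proof -
  have ker: "mat_kernel Q = {\<Phi> *\<^sub>v c | c. c \<in> carrier_vec d}"
    using basis_matrix_range[OF is_subspace_mat_kernel[OF Q] \<Phi>] \<Phi>c by simp
  have QY0: "Q * Y0 \<in> carrier_mat n s" using Q Y0 by simp
  have Q\<Phi>: "Q * \<Phi> = 0\<^sub>m n d"
  proof (rule mat_col_eqI)
    fix j assume "j < dim_col (0\<^sub>m n d :: real mat)"
    hence j: "j < d" by simp
    have "col \<Phi> j = \<Phi> *\<^sub>v unit_vec d j"
      using col_mult2[OF \<Phi>c one_carrier_mat j]
      unfolding right_mult_one_mat[OF \<Phi>c] col_one[OF j] .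
    hence "col \<Phi> j \<in> mat_kernel Q" unfolding ker using unit_vec_carrier by blast
    thus "col (Q * \<Phi>) j = col (0\<^sub>m n d) j"
      using mat_kernelD(2)[OF Q] j unfolding col_mult2[OF Q \<Phi>c j] by simp
  qed (use Q \<Phi>c in simp_all)
  show ?thesis
  proof (intro Set.set_eqI iffI)
    fix Y assume "Y \<in> {Y \<in> carrier_mat q s. Q * Y = Q * Y0}"
    hence Y: "Y \<in> carrier_mat q s" and QY: "Q * Y = Q * Y0" by auto
    have D: "Y - Y0 \<in> carrier_mat q s" by (rule minus_carrier_mat[OF Y0])
    have QD: "Q * (Y - Y0) = 0\<^sub>m n s"
      unfolding mult_minus_distrib_mat[OF Q Y Y0] QY using QY0 by simp
    have "\<exists>c \<in> carrier_vec d. col (Y - Y0) j = \<Phi> *\<^sub>v c" if j: "j < s" for j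
    proof -
      have "Q *\<^sub>v col (Y - Y0) j = 0\<^sub>v n"
        using col_mult2[OF Q D j] j unfolding QD by simp
      moreover have "col (Y - Y0) j \<in> carrier_vec q"
        by (rule col_carrier_vec) (use D j in auto)
      ultimately show ?thesis using mat_kernelI[OF Q] ker by blast
    qed
    then obtain H where H: "H \<in> carrier_mat d s" and "Y - Y0 = \<Phi> * H"
      using factor_through_range[OF \<Phi>c D] by blast
    hence "Y = Y0 + \<Phi> * H" using minus_mat_eqD[OF Y Y0] by simp
    thus "Y \<in> {Y0 + \<Phi> * H | H. H \<in> carrier_mat d s}" using H by blast
  next
    fix Y assume "Y \<in> {Y0 + \<Phi> * H | H. H \<in> carrier_mat d s}"
    then obtain H where H: "H \<in> carrier_mat d s" and Y: "Y = Y0 + \<Phi> * H"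
      by blast
    have \<Phi>H: "\<Phi> * H \<in> carrier_mat q s" using \<Phi>c H by simp
    have "Q * Y = Q * Y0 + Q * \<Phi> * H"
      unfolding Y mult_add_distrib_mat[OF Q Y0 \<Phi>H] assoc_mult_mat[OF Q \<Phi>c H] ..
    also have "\<dots> = Q * Y0" unfolding Q\<Phi> using QY0 H by simp
    finally show "Y \<in> {Y \<in> carrier_mat q s. Q * Y = Q * Y0}" using Y Y0 \<Phi>H by simp
  qed
qed

text \<open>The pair of unknowns is solved as one stacked matrix \<open>L @\<^sub>r T\<close>;
  existential quantification over \<open>L\<close> then amounts to reading off the lower block of
  the general solution.\<close>

lemma range_condition_solutions:
  assumes N: "N \<in> carrier_mat n l" and B: "B \<in> carrier_mat n m" and G: "G \<in> carrier_mat n s"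
    and R1: "R1 \<in> carrier_mat l n" and R2: "R2 \<in> carrier_mat m n"
    and R: "R1 @\<^sub>r R2 = pinv (N @\<^sub>c B)"
    and \<Phi>: "is_basis_matrix (l + m) (mat_kernel (N @\<^sub>c B)) (\<Phi>1 @\<^sub>r \<Phi>2)"
    and \<Phi>1: "\<Phi>1 \<in> carrier_mat l d" and \<Phi>2: "\<Phi>2 \<in> carrier_mat m d"
    and solvable: "\<exists>T \<in> carrier_mat m s. \<exists>L \<in> carrier_mat l s. N * L + B * T = G"
  shows "{T \<in> carrier_mat m s. \<exists>L \<in> carrier_mat l s. N * L + B * T = G} =
    {R2 * G + \<Phi>2 * H | H. H \<in> carrier_mat d s}"
proof -
  let ?Q = "N @\<^sub>c B"
  have Q: "?Q \<in> carrier_mat n (l + m)" using append_cols_carrier[OF N B] .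
  have block: "?Q * (L @\<^sub>r T) = N * L + B * T"
    if "L \<in> carrier_mat l s" "T \<in> carrier_mat m s" for L T
    using append_cols_mult_append_rows[OF N B that] .
  have RG: "(R1 @\<^sub>r R2) * G \<in> carrier_mat (l + m) s"
    using carrier_append_rows[OF R1 R2] G by simp
  obtain L0 T0 where L0: "L0 \<in> carrier_mat l s" and T0: "T0 \<in> carrier_mat m s"
    and eq0: "N * L0 + B * T0 = G" using solvable by blast
  \<comment> \<open>Solvability enters here: it places \<open>G\<close> in the range of
    \<open>?Q\<close>, so the pseudoinverse yields a particular solution.\<close>
  have "?Q * ((R1 @\<^sub>r R2) * G) = G"
    unfolding R using mult_pinv_solution[OF Q carrier_append_rows[OF L0 T0]] block[OF L0 T0] eq0
    by simp
  note sols = linear_system_solutions[OF Q RG \<Phi> carrier_append_rows[OF \<Phi>1 \<Phi>2], unfolded this]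
  have expand: "(R1 @\<^sub>r R2) * G + (\<Phi>1 @\<^sub>r \<Phi>2) * H
      = (R1 * G + \<Phi>1 * H) @\<^sub>r (R2 * G + \<Phi>2 * H)" if H: "H \<in> carrier_mat d s" for H
    unfolding append_rows_mult[OF R1 R2 G] append_rows_mult[OF \<Phi>1 \<Phi>2 H]
    by (rule append_rows_add) (use R1 R2 G \<Phi>1 \<Phi>2 H in auto)
  show ?thesis
  proof (intro Set.set_eqI iffI)
    fix T assume "T \<in> {T \<in> carrier_mat m s. \<exists>L \<in> carrier_mat l s. N * L + B * T = G}"
    then obtain L where T: "T \<in> carrier_mat m s" and L: "L \<in> carrier_mat l s"
      and eq: "N * L + B * T = G" by blast
    have "L @\<^sub>r T \<in> {Y \<in> carrier_mat (l + m) s. ?Q * Y = G}"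
      using block[OF L T] eq L T by auto
    then obtain H where H: "H \<in> carrier_mat d s"
      and LT: "L @\<^sub>r T = (R1 * G + \<Phi>1 * H) @\<^sub>r (R2 * G + \<Phi>2 * H)"
      unfolding sols using expand by auto
    have "T = R2 * G + \<Phi>2 * H"
      by (rule append_rows_eqD(2)[OF L T _ _ LT]) (use R1 R2 G \<Phi>1 \<Phi>2 H in auto)
    thus "T \<in> {R2 * G + \<Phi>2 * H | H. H \<in> carrier_mat d s}" using H by blast
  next
    fix T assume "T \<in> {R2 * G + \<Phi>2 * H | H. H \<in> carrier_mat d s}"
    then obtain H where H: "H \<in> carrier_mat d s" and T: "T = R2 * G + \<Phi>2 * H" by blast
    \<comment> \<open>The upper block with the same \<open>H\<close> serves as the witness for
      \<open>L\<close>.\<close>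
    have Tc: "T \<in> carrier_mat m s" and Lc: "R1 * G + \<Phi>1 * H \<in> carrier_mat l s"
      using T R1 R2 G \<Phi>1 \<Phi>2 H by auto
    have "(R1 * G + \<Phi>1 * H) @\<^sub>r T \<in> {Y \<in> carrier_mat (l + m) s. ?Q * Y = G}"
      unfolding sols T expand[OF H, symmetric] using H by blast
    hence "N * (R1 * G + \<Phi>1 * H) + B * T = G" using block[OF Lc Tc] by simp
    thus "T \<in> {T \<in> carrier_mat m s. \<exists>L \<in> carrier_mat l s. N * L + B * T = G}"
      using Tc Lc by blast
  qed
qed

text \<open>From \<open>X * pinv X * X = X\<close>, every column of
  \<open>pinv X * X - 1\<^sub>m s\<close> is annihilated by \<open>X\<close>, hence zero by
  injectivity.\<close>

lemma pinv_mult_full_col_rank: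
  assumes X: "X \<in> carrier_mat p s"
    and inj: "\<And>c. c \<in> carrier_vec s \<Longrightarrow> X *\<^sub>v c = 0\<^sub>v p \<Longrightarrow> c = 0\<^sub>v s"
  shows "pinv X * X = 1\<^sub>m s"
proof -
  let ?P = "pinv X"
  have P: "?P \<in> carrier_mat s p" using pinv_carrier[OF X] .
  have PX: "?P * X \<in> carrier_mat s s" using P X by simp
  have D: "?P * X - 1\<^sub>m s \<in> carrier_mat s s" by (rule minus_carrier_mat[OF one_carrier_mat])
  have "X * (?P * X) = X * 1\<^sub>m s"
    using mult_pinv_mult[of X] X unfolding assoc_mult_mat[OF X P X] by simp
  hence XD: "X * (?P * X - 1\<^sub>m s) = 0\<^sub>m p s"
    using mult_minus_distrib_mat[OF X PX one_carrier_mat] X by simp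
  have "?P * X - 1\<^sub>m s = 0\<^sub>m s s"
  proof (rule mat_col_eqI)
    fix j assume "j < dim_col (0\<^sub>m s s :: real mat)"
    hence j: "j < s" by simp
    have "X *\<^sub>v col (?P * X - 1\<^sub>m s) j = 0\<^sub>v p"
      using col_mult2[OF X D j] j unfolding XD by simp
    moreover have "col (?P * X - 1\<^sub>m s) j \<in> carrier_vec s"
      by (rule col_carrier_vec) (use D j in auto)
    ultimately show "col (?P * X - 1\<^sub>m s) j = col (0\<^sub>m s s) j"
      using inj j by simp
  qed simp_all
  thus ?thesis using minus_mat_eqD[OF PX one_carrier_mat] by simp
qed

lemma transpose_mat_inject: "transpose_mat X = transpose_mat Y \<longleftrightarrow> X = Y"
  by (metis transpose_transpose)

lemma transpose_mult_eq_iff: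
  fixes K X S :: "'a :: comm_semiring_0 mat"
  assumes "K \<in> carrier_mat m p" "X \<in> carrier_mat p s"
  shows "transpose_mat X * transpose_mat K = transpose_mat S \<longleftrightarrow> K * X = S"
  unfolding transpose_mult[OF assms, symmetric] by (rule transpose_mat_inject)

text \<open>Transposition turns \<open>K * X = S\<close> into a system with the unknown on the
  right, whose kernel is the left null-space of \<open>X\<close>.\<close>

lemma left_mult_solutions:
  assumes X: "X \<in> carrier_mat p s"
    and inj: "\<And>c. c \<in> carrier_vec s \<Longrightarrow> X *\<^sub>v c = 0\<^sub>v p \<Longrightarrow> c = 0\<^sub>v s"
    and S: "S \<in> carrier_mat m s"
    and \<Psi>: "is_left_null_basis_matrix X \<Psi>"
  shows "{K \<in> carrier_mat m p. K * X = S} = {S * pinv X + H * \<Psi> | H. H \<in> carrier_mat m (dim_row \<Psi>)}"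
proof -
  define d where "d = dim_row \<Psi>"
  let ?T = transpose_mat
  let ?K0 = "S * pinv X"
  have P: "pinv X \<in> carrier_mat s p" using pinv_carrier[OF X] .
  have K0: "?K0 \<in> carrier_mat m p" using S P by simp
  have XT: "?T X \<in> carrier_mat s p" and K0T: "?T ?K0 \<in> carrier_mat p m" using X K0 by auto
  have \<Psi>c: "\<Psi> \<in> carrier_mat d p"
    using \<Psi> X unfolding is_left_null_basis_matrix_def d_def by auto
  have \<Psi>Tc: "?T \<Psi> \<in> carrier_mat p d" using \<Psi>c by simp
  have \<Psi>T: "is_basis_matrix p (mat_kernel (?T X)) (?T \<Psi>)"
    using \<Psi> X \<Psi>c unfolding is_left_null_basis_matrix_def is_basis_matrix_def left_null_space_def
    by simp
  \<comment> \<open>Full column rank makes the pseudoinverse a left inverse of \<open>X\<close>, so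
    the equation is solvable for every \<open>S\<close>.\<close>
  have "?K0 * X = S"
    using S pinv_mult_full_col_rank[OF X inj] unfolding assoc_mult_mat[OF S P X] by simp
  hence K0X: "?T X * ?T ?K0 = ?T S" using transpose_mult_eq_iff[OF K0 X] by blast
  note sols = linear_system_solutions[OF XT K0T \<Psi>T \<Psi>Tc, unfolded K0X]
  have tr: "?T (?K0 + H * \<Psi>) = ?T ?K0 + ?T \<Psi> * ?T H" if H: "H \<in> carrier_mat m d" for H
  proof -
    have "H * \<Psi> \<in> carrier_mat m p" using H \<Psi>c by simp
    thus ?thesis using transpose_add[OF K0] transpose_mult[OF H \<Psi>c] by simp
  qed
  show ?thesis
    unfolding d_def[symmetric]
  proof (intro Set.set_eqI iffI)
    fix K assume "K \<in> {K \<in> carrier_mat m p. K * X = S}"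
    hence K: "K \<in> carrier_mat m p" and "K * X = S" by auto
    hence "?T X * ?T K = ?T S" using transpose_mult_eq_iff[OF K X] by blast
    hence "?T K \<in> {Y \<in> carrier_mat p m. ?T X * Y = ?T S}" using K by simp
    then obtain H where H: "H \<in> carrier_mat d m" and KH: "?T K = ?T ?K0 + ?T \<Psi> * H"
      unfolding sols by blast
    have HT: "?T H \<in> carrier_mat m d" using H by simp
    have "?T K = ?T (?K0 + ?T H * \<Psi>)" unfolding tr[OF HT] using KH by simp
    hence "K = ?K0 + ?T H * \<Psi>" by (simp only: transpose_mat_inject)
    thus "K \<in> {?K0 + H * \<Psi> | H. H \<in> carrier_mat m d}" using HT by blast
  next
    fix K assume "K \<in> {?K0 + H * \<Psi> | H. H \<in> carrier_mat m d}"
    then obtain H where H: "H \<in> carrier_mat m d" and KH: "K = ?K0 + H * \<Psi>" by blast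
    have K: "K \<in> carrier_mat m p" using KH K0 H \<Psi>c by simp
    have HT: "?T H \<in> carrier_mat d m" using H by simp
    have "?T K \<in> {Y \<in> carrier_mat p m. ?T X * Y = ?T S}"
      unfolding sols KH tr[OF H] using HT by blast
    hence "K * X = S" using transpose_mult_eq_iff[OF K X] by blast
    thus "K \<in> {K \<in> carrier_mat m p. K * X = S}" using K by simp
  qed
qed

section \<open>Splitting along the kernel\<close>

lemma mat_of_cols_append_mult_vec:
  fixes c d :: "'a :: comm_semiring_0 vec"
  assumes c: "c \<in> carrier_vec (length xs)" and d: "d \<in> carrier_vec (length ys)"
  shows "mat_of_cols n (xs @ ys) *\<^sub>v (c @\<^sub>v d) = mat_of_cols n xs *\<^sub>v c + mat_of_cols n ys *\<^sub>v d"
proof (rule eq_vecI)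
  fix i assume "i < dim_vec (mat_of_cols n xs *\<^sub>v c + mat_of_cols n ys *\<^sub>v d)"
  hence i: "i < n" by simp
  have row: "row (mat_of_cols n (xs @ ys)) i = row (mat_of_cols n xs) i @\<^sub>v row (mat_of_cols n ys) i"
    using i by (intro eq_vecI) (auto simp: mat_of_cols_def nth_append)
  have "row (mat_of_cols n (xs @ ys)) i \<bullet> (c @\<^sub>v d)
    = row (mat_of_cols n xs) i \<bullet> c + row (mat_of_cols n ys) i \<bullet> d"
    unfolding row
    by (rule scalar_prod_append[OF row_carrier_vec[OF i mat_of_cols_carrier(1)]
      row_carrier_vec[OF i mat_of_cols_carrier(1)] c d])
  thus "(mat_of_cols n (xs @ ys) *\<^sub>v (c @\<^sub>v d)) $ i
    = (mat_of_cols n xs *\<^sub>v c + mat_of_cols n ys *\<^sub>v d) $ i"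
    using i by simp
qed simp

lemma basis_list_append_range:
  assumes "is_subspace n W" and "is_basis_list n W (xs @ ys)"
  shows "W = {mat_of_cols n xs *\<^sub>v c + mat_of_cols n ys *\<^sub>v d | c d.
    c \<in> carrier_vec (length xs) \<and> d \<in> carrier_vec (length ys)}"
proof -
  have "W = {mat_of_cols n (xs @ ys) *\<^sub>v e | e. e \<in> carrier_vec (length xs + length ys)}"
    using basis_list_range[OF assms] by simp
  also have "\<dots> = {mat_of_cols n xs *\<^sub>v c + mat_of_cols n ys *\<^sub>v d | c d.
    c \<in> carrier_vec (length xs) \<and> d \<in> carrier_vec (length ys)}"
  proof (intro Set.set_eqI iffI)
    fix v
    assume "v \<in> {mat_of_cols n (xs @ ys) *\<^sub>v e | e. e \<in> carrier_vec (length xs + length ys)}"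
    then obtain e where e: "e \<in> carrier_vec (length xs + length ys)"
      and v: "v = mat_of_cols n (xs @ ys) *\<^sub>v e" by blast
    have "e = vec_first e (length xs) @\<^sub>v vec_last e (length ys)"
      using vec_first_last_append[OF e] by simp
    hence "v = mat_of_cols n xs *\<^sub>v vec_first e (length xs) + mat_of_cols n ys *\<^sub>v vec_last e (length ys)"
      using v mat_of_cols_append_mult_vec[of "vec_first e (length xs)" xs "vec_last e (length ys)" ys n]
      by simp
    thus "v \<in> {mat_of_cols n xs *\<^sub>v c + mat_of_cols n ys *\<^sub>v d | c d.
      c \<in> carrier_vec (length xs) \<and> d \<in> carrier_vec (length ys)}"
      using vec_first_carrier vec_last_carrier by blast
  next
    fix v
    assume "v \<in> {mat_of_cols n xs *\<^sub>v c + mat_of_cols n ys *\<^sub>v d | c d.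
      c \<in> carrier_vec (length xs) \<and> d \<in> carrier_vec (length ys)}"
    then obtain c d where c: "c \<in> carrier_vec (length xs)" and d: "d \<in> carrier_vec (length ys)"
      and v: "v = mat_of_cols n xs *\<^sub>v c + mat_of_cols n ys *\<^sub>v d" by blast
    have "c @\<^sub>v d \<in> carrier_vec (length xs + length ys)" using c d by simp
    thus "v \<in> {mat_of_cols n (xs @ ys) *\<^sub>v e | e. e \<in> carrier_vec (length xs + length ys)}"
      using mat_of_cols_append_mult_vec[OF c d, of n, symmetric] v by blast
  qed
  finally show ?thesis .
qed

text \<open>A combination of \<open>ys\<close> killed by \<open>C\<close> lies in
  \<open>W \<inter> mat_kernel C\<close>, so it is also a combination of \<open>xs\<close>;
  independence of \<open>xs @ ys\<close> leaves only the trivial one. Thus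
  \<open>C * mat_of_cols n ys\<close> has full column rank.\<close>

lemma complement_independent_mod_kernel:
  assumes W: "is_subspace n W" and C: "C \<in> carrier_mat p n"
    and basis: "is_basis_list n W (xs @ ys)"
    and ker: "is_basis_list n (W \<inter> mat_kernel C) xs"
    and c: "c \<in> carrier_vec (length ys)" and 0: "C * mat_of_cols n ys *\<^sub>v c = 0\<^sub>v p"
  shows "c = 0\<^sub>v (length ys)"
proof -
  let ?X = "mat_of_cols n xs" and ?Y = "mat_of_cols n ys"
  have X: "?X \<in> carrier_mat n (length xs)" and Y: "?Y \<in> carrier_mat n (length ys)" by auto
  have Yc: "?Y *\<^sub>v c \<in> carrier_vec n" using mult_mat_vec_carrier[OF Y c] .
  have "?X *\<^sub>v 0\<^sub>v (length xs) = 0\<^sub>v n" by (intro eq_vecI) auto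
  hence "?Y *\<^sub>v c = ?X *\<^sub>v 0\<^sub>v (length xs) + ?Y *\<^sub>v c" using Yc by simp
  hence "?Y *\<^sub>v c \<in> W"
    unfolding basis_list_append_range[OF W basis] using c zero_carrier_vec by blast
  moreover have "?Y *\<^sub>v c \<in> mat_kernel C"
    using mat_kernelI[OF C Yc] 0 assoc_mult_mat_vec[OF C Y c] by simp
  ultimately obtain d where d: "d \<in> carrier_vec (length xs)" and eq: "?Y *\<^sub>v c = ?X *\<^sub>v d"
    using basis_list_range[OF is_subspace_Int[OF W is_subspace_mat_kernel[OF C]] ker] by blast
  have Xd: "?X *\<^sub>v d \<in> carrier_vec n" using mult_mat_vec_carrier[OF X d] .
  \<comment> \<open>The equality of the two combinations becomes a kernel vector of the full basis
    matrix, with coefficients \<open>- d\<close> on \<open>xs\<close> and \<open>c\<close> on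
    \<open>ys\<close>.\<close>
  have "?X *\<^sub>v (- d) = - (?X *\<^sub>v d)" using d by (intro eq_vecI) auto
  hence "mat_of_cols n (xs @ ys) *\<^sub>v ((- d) @\<^sub>v c) = - (?X *\<^sub>v d) + ?X *\<^sub>v d"
    using mat_of_cols_append_mult_vec[of "- d" xs c ys n] c d eq X by simp
  also have "\<dots> = 0\<^sub>v n" using Xd by simp
  finally have "(- d) @\<^sub>v c = 0\<^sub>v (length (xs @ ys))"
    using basis_list_independent[OF W basis, of "(- d) @\<^sub>v c"] c d by simp
  also have "\<dots> = 0\<^sub>v (length xs) @\<^sub>v 0\<^sub>v (length ys)" by auto
  finally show ?thesis using append_vec_eq[of "- d" "length xs" "0\<^sub>v (length xs)"] d by simp
qed

text \<open>\<open>W\<close> is the sum of the spans of \<open>xs\<close> and \<open>ys\<close>. The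
  first span is \<open>W \<inter> mat_kernel C\<close>; on the second, mapping into \<open>V\<close>
  means that the columns of \<open>D * mat_of_cols n ys\<close> lie in the range of
  \<open>N\<close>.\<close>

lemma image_subset_iff_kernel_and_complement:
  assumes W: "is_subspace n W" and V: "is_subspace l V" and C: "C \<in> carrier_mat p n"
    and basis: "is_basis_list n W (xs @ ys)"
    and ker: "is_basis_list n (W \<inter> mat_kernel C) xs"
    and N: "is_basis_matrix l V N" and Nc: "N \<in> carrier_mat l q"
    and D: "D \<in> carrier_mat l n"
  shows "(\<lambda>v. D *\<^sub>v v) ` W \<subseteq> V \<longleftrightarrow> (\<lambda>v. D *\<^sub>v v) ` (W \<inter> mat_kernel C) \<subseteq> V \<and>
    (\<exists>L \<in> carrier_mat q (length ys). D * mat_of_cols n ys = N * L)"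
proof (intro iffI conjI; (elim conjE)?)
  let ?X = "mat_of_cols n xs" and ?Y = "mat_of_cols n ys"
  have X: "?X \<in> carrier_mat n (length xs)" and Y: "?Y \<in> carrier_mat n (length ys)" by auto
  have V_eq: "V = {N *\<^sub>v c | c. c \<in> carrier_vec q}" 
    using basis_matrix_range[OF V N] Nc by simp
  {
    assume sub: "(\<lambda>v. D *\<^sub>v v) ` W \<subseteq> V"
    thus "(\<lambda>v. D *\<^sub>v v) ` (W \<inter> mat_kernel C) \<subseteq> V" by auto
    have DY: "D * ?Y \<in> carrier_mat l (length ys)" using D Y by simp
    have "\<exists>c \<in> carrier_vec q. col (D * ?Y) j = N *\<^sub>v c" if j: "j < length ys" for j
    proof -
      have "ys ! j \<in> W"
        using basis[unfolded basis_list_iff[OF W]] j by auto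
      hence "D *\<^sub>v (ys ! j) \<in> V" and "ys ! j \<in> carrier_vec n"
        using sub subspace_carrier[OF W] by auto
      moreover have "col (D * ?Y) j = D *\<^sub>v (ys ! j)"
        using col_mult2[OF D Y j] j calculation(2) by simp
      ultimately show ?thesis unfolding V_eq by auto
    qed
    then obtain L where "L \<in> carrier_mat q (length ys)" "D * ?Y = N * L"
      using factor_through_range[OF Nc DY] by blast
    thus "\<exists>L \<in> carrier_mat q (length ys). D * ?Y = N * L" by blast
  }
  assume sub: "(\<lambda>v. D *\<^sub>v v) ` (W \<inter> mat_kernel C) \<subseteq> V"
    and "\<exists>L \<in> carrier_mat q (length ys). D * ?Y = N * L"
  then obtain L where L: "L \<in> carrier_mat q (length ys)" and DYL: "D * ?Y = N * L"
    by blast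
  show "(\<lambda>v. D *\<^sub>v v) ` W \<subseteq> V"
  proof
    fix w assume "w \<in> (\<lambda>v. D *\<^sub>v v) ` W"
    then obtain c d where c: "c \<in> carrier_vec (length xs)" and d: "d \<in> carrier_vec (length ys)"
      and w: "w = D *\<^sub>v (?X *\<^sub>v c + ?Y *\<^sub>v d)"
      unfolding basis_list_append_range[OF W basis] by auto
    have "?X *\<^sub>v c \<in> W \<inter> mat_kernel C"
      using basis_list_range[OF is_subspace_Int[OF W is_subspace_mat_kernel[OF C]] ker] c by blast
    hence 1: "D *\<^sub>v (?X *\<^sub>v c) \<in> V" using sub by blast
    have "D *\<^sub>v (?Y *\<^sub>v d) = N *\<^sub>v (L *\<^sub>v d)"
      unfolding assoc_mult_mat_vec[OF D Y d, symmetric] DYL assoc_mult_mat_vec[OF Nc L d] ..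
    hence 2: "D *\<^sub>v (?Y *\<^sub>v d) \<in> V" unfolding V_eq using mult_mat_vec_carrier[OF L d] by blast
    show "w \<in> V"
      unfolding w mult_add_distrib_mat_vec[OF D mult_mat_vec_carrier[OF X c] mult_mat_vec_carrier[OF Y d]]
      by (rule is_subspaceD(2)[OF V 1 2])
  qed
qed

text \<open>The right-hand side is never empty, as \<open>H1\<close> and \<open>H2\<close> may be
  zero; \<open>solvable\<close> therefore rules out the case in which no admissible \<open>K\<close>
  exists. The sizes of the parameters are read off from the basis matrices and may be zero.\<close>

theorem theorem1:
  fixes n1 n2 m p k :: nat
    and \<M> \<N> :: "real vec set"
    and A B C N M R1 R2 \<Phi> \<Phi>1 \<Phi>2 \<Psi> :: "real mat"
    and ms :: "real vec list"
  assumes "n1 > 0" and "n2 > 0" and "m > 0" and "p > 0"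
    and "is_subspace n2 \<M>" and "is_subspace n1 \<N>"
    and "A \<in> carrier_mat n1 n2" and "B \<in> carrier_mat n1 m" and "C \<in> carrier_mat p n2"
    and "is_basis_matrix n1 \<N> N"
    and "is_basis_list n2 \<M> ms"
    and "k \<le> length ms"
    and "is_basis_list n2 (\<M> \<inter> mat_kernel C) (take k ms)"
    and "M = mat_of_cols n2 (drop k ms)"
    and "R1 \<in> carrier_mat (dim_col N) n1" and "R2 \<in> carrier_mat m n1"
    and "R1 @\<^sub>r R2 = pinv (N @\<^sub>c B)"
    and "is_basis_matrix (dim_col N + m) (mat_kernel (N @\<^sub>c B)) \<Phi>"
    and "\<Phi>1 \<in> carrier_mat (dim_col N) (dim_col \<Phi>)" and "\<Phi>2 \<in> carrier_mat m (dim_col \<Phi>)"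
    and "\<Phi> = \<Phi>1 @\<^sub>r \<Phi>2"
    and "is_left_null_basis_matrix (C * M) \<Psi>"
    and solvable: "{K \<in> carrier_mat m p. (\<lambda>v. (A + B * K * C) *\<^sub>v v) ` \<M> \<subseteq> \<N>} \<noteq> {}"
  shows "{K \<in> carrier_mat m p. (\<lambda>v. (A + B * K * C) *\<^sub>v v) ` \<M> \<subseteq> \<N>} =
    {- R2 * A * M * pinv (C * M) - \<Phi>2 * H1 * pinv (C * M) + H2 * \<Psi> | H1 H2.
       H1 \<in> carrier_mat (dim_col \<Phi>) (dim_col M) \<and> H2 \<in> carrier_mat m (dim_row \<Psi>)}"
proof -
  define l d s where "l = dim_col N" and "d = dim_col \<Phi>" and "s = length (drop k ms)"
  note defs = l_def[symmetric] d_def[symmetric] s_def[symmetric]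
  let ?V = "\<M> \<inter> mat_kernel C"
  let ?X = "C * M"
  let ?G = "A * M"
  let ?P = "pinv ?X"
  have A: "A \<in> carrier_mat n1 n2" and B: "B \<in> carrier_mat n1 m" and C: "C \<in> carrier_mat p n2"
    by fact+
  have \<M>: "is_subspace n2 \<M>" and \<N>: "is_subspace n1 \<N>" by fact+
  have basis: "is_basis_list n2 \<M> (take k ms @ drop k ms)"
    using \<open>is_basis_list n2 \<M> ms\<close> by simp
  have ker: "is_basis_list n2 ?V (take k ms)" by fact
  have M_def: "M = mat_of_cols n2 (drop k ms)" by fact
  have M: "M \<in> carrier_mat n2 s" unfolding M_def s_def by (rule mat_of_cols_carrier)
  have s: "dim_col M = s" using M by simp
  have N_basis: "is_basis_matrix n1 \<N> N" by fact
  have N: "N \<in> carrier_mat n1 l" using N_basis unfolding is_basis_matrix_def l_def by auto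
  have R1: "R1 \<in> carrier_mat l n1" and R2: "R2 \<in> carrier_mat m n1"
    using assms(15,16) unfolding l_def .
  have \<Phi>1: "\<Phi>1 \<in> carrier_mat l d" and \<Phi>2: "\<Phi>2 \<in> carrier_mat m d"
    using assms(19,20) unfolding l_def d_def .
  have \<Phi>: "is_basis_matrix (l + m) (mat_kernel (N @\<^sub>c B)) (\<Phi>1 @\<^sub>r \<Phi>2)"
    using assms(18,21) unfolding l_def by simp
  have X: "?X \<in> carrier_mat p s" and G: "?G \<in> carrier_mat n1 s" using A C M by auto
  have P: "?P \<in> carrier_mat s p" using pinv_carrier[OF X] .
  have X_inj: "c = 0\<^sub>v s" if "c \<in> carrier_vec s" "?X *\<^sub>v c = 0\<^sub>v p" for c
    using complement_independent_mod_kernel[OF \<M> C basis ker] that unfolding M_def s_def .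

  define \<K> where "\<K> = {K \<in> carrier_mat m p. (\<lambda>v. (A + B * K * C) *\<^sub>v v) ` \<M> \<subseteq> \<N>}"
  \<comment> \<open>The candidate values of \<open>- (K * ?X)\<close>. With this sign,
    \<open>?G + B * (K * ?X) = N * L\<close> takes the form of a system with coefficient matrix
    \<open>N @\<^sub>c B\<close>.\<close>
  define \<T> where "\<T> = {T \<in> carrier_mat m s. \<exists>L \<in> carrier_mat l s. N * L + B * T = ?G}"
  have split: "K \<in> \<K> \<longleftrightarrow> (\<lambda>v. A *\<^sub>v v) ` ?V \<subseteq> \<N> \<and> - (K * ?X) \<in> \<T>"
    if K: "K \<in> carrier_mat m p" for K
  proof -
    let ?D = "A + B * K * C"
    have BK: "B * K \<in> carrier_mat n1 p" and BKC: "B * K * C \<in> carrier_mat n1 n2"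
      using B K C by auto
    have D: "?D \<in> carrier_mat n1 n2" using BKC by simp
    have KX: "K * ?X \<in> carrier_mat m s" using K X by simp
    have BKX: "B * (K * ?X) \<in> carrier_mat n1 s" using B KX by simp
    \<comment> \<open>On the kernel of \<open>C\<close> the feedback term vanishes, so this half of
      the condition is independent of \<open>K\<close>.\<close>
    have "?D *\<^sub>v v = A *\<^sub>v v" if "v \<in> ?V" for v
    proof -
      have v: "v \<in> carrier_vec n2" and Cv: "C *\<^sub>v v = 0\<^sub>v p"
        using that mat_kernelD[OF C] by auto
      have "B * K *\<^sub>v 0\<^sub>v p = 0\<^sub>v n1" using BK B by (intro eq_vecI) auto
      hence "?D *\<^sub>v v = A *\<^sub>v v + 0\<^sub>v n1"
        using add_mult_distrib_mat_vec[OF A BKC v] assoc_mult_mat_vec[OF BK C v] Cv by simp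
      thus ?thesis using mult_mat_vec_carrier[OF A v] by simp
    qed
    hence ker_image: "(\<lambda>v. ?D *\<^sub>v v) ` ?V = (\<lambda>v. A *\<^sub>v v) ` ?V" by (rule image_cong[OF refl])
    have DM: "?D * M = ?G + B * (K * ?X)"
      unfolding add_mult_distrib_mat[OF A BKC M] assoc_mult_mat[OF BK C M] assoc_mult_mat[OF B K X] ..
    have "?D * M = N * L \<longleftrightarrow> N * L + B * - (K * ?X) = ?G" if L: "L \<in> carrier_mat l s" for L
    proof -
      have NL: "N * L \<in> carrier_mat n1 s" using N L by simp
      have neg: "B * - (K * ?X) = - (B * (K * ?X))"
        by (rule uminus_mult_right_mat) (use B K in simp)
      show ?thesis unfolding DM neg by (rule add_eq_iff_mat[OF G BKX NL])
    qed
    moreover have "- (K * ?X) \<in> carrier_mat m s" using KX by simp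
    ultimately have "(\<exists>L \<in> carrier_mat l s. ?D * M = N * L) \<longleftrightarrow> - (K * ?X) \<in> \<T>"
      unfolding \<T>_def by blast
    thus ?thesis
      using image_subset_iff_kernel_and_complement[OF \<M> \<N> C basis ker N_basis N D,
          unfolded ker_image, folded M_def, unfolded defs] K
      unfolding \<K>_def by blast
  qed
  \<comment> \<open>One admissible \<open>K0\<close> yields both the inclusion on the kernel part,
    valid then for all \<open>K\<close>, and the consistency of the linear system.\<close>
  obtain K0 where K0: "K0 \<in> carrier_mat m p" "K0 \<in> \<K>" using solvable unfolding \<K>_def by blast
  hence A_ker: "(\<lambda>v. A *\<^sub>v v) ` ?V \<subseteq> \<N>" and "- (K0 * ?X) \<in> \<T>" using split by blast+
  hence "\<exists>T \<in> carrier_mat m s. \<exists>L \<in> carrier_mat l s. N * L + B * T = ?G"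
    unfolding \<T>_def by blast
  note \<T>_eq = range_condition_solutions[OF N B G R1 R2 assms(17) \<Phi> \<Phi>1 \<Phi>2 this, folded \<T>_def]
  have formula: "- (R2 * ?G + \<Phi>2 * H1) * ?P + H2 * \<Psi>
      = - R2 * A * M * ?P - \<Phi>2 * H1 * ?P + H2 * \<Psi>"
    if H1: "H1 \<in> carrier_mat d s" for H1 H2
  proof -
    have R2G: "R2 * ?G \<in> carrier_mat m s" and \<Phi>H: "\<Phi>2 * H1 \<in> carrier_mat m s"
      and R2': "- R2 \<in> carrier_mat m n1"
      using R2 G \<Phi>2 H1 by auto
    have "- R2 * A * M = - (R2 * ?G)"
      unfolding assoc_mult_mat[OF R2' A M] by (rule uminus_mult_left_mat) (use R2 A in simp)
    moreover have "- (R2 * ?G + \<Phi>2 * H1) = - (R2 * ?G) - \<Phi>2 * H1"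
      by (rule uminus_add_mat[OF R2G \<Phi>H])
    moreover have "- (R2 * ?G) \<in> carrier_mat m s" using R2G by simp
    ultimately show ?thesis using minus_mult_distrib_mat[OF _ \<Phi>H P] by simp
  qed
  have "K \<in> \<K> \<longleftrightarrow> (\<exists>H1 H2. K = - R2 * A * M * ?P - \<Phi>2 * H1 * ?P + H2 * \<Psi> \<and>
      H1 \<in> carrier_mat d s \<and> H2 \<in> carrier_mat m (dim_row \<Psi>))" for K
  proof -
    have "K \<in> \<K> \<longleftrightarrow> K \<in> carrier_mat m p \<and> - (K * ?X) \<in> \<T>"
      using split A_ker unfolding \<K>_def by blast
    also have "\<dots> \<longleftrightarrow> (\<exists>H1 \<in> carrier_mat d s.
        K \<in> {K \<in> carrier_mat m p. K * ?X = - (R2 * ?G + \<Phi>2 * H1)})"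
    proof -
      have "- (K * ?X) = T \<longleftrightarrow> K * ?X = - T" for T by (metis uminus_uminus_mat)
      thus ?thesis unfolding \<T>_eq by blast
    qed
    also have "\<dots> \<longleftrightarrow> (\<exists>H1 \<in> carrier_mat d s.
        K \<in> {- (R2 * ?G + \<Phi>2 * H1) * ?P + H2 * \<Psi> | H2. H2 \<in> carrier_mat m (dim_row \<Psi>)})"
    \<comment> \<open>For each fixed \<open>H1\<close> the right-hand side is a fixed matrix, so the
      solutions in \<open>K\<close> are parameterized by \<open>H2\<close> independently of
      \<open>H1\<close>.\<close>
    proof (rule bex_cong[OF refl])
      fix H1 :: "real mat" assume "H1 \<in> carrier_mat d s"
      hence "- (R2 * ?G + \<Phi>2 * H1) \<in> carrier_mat m s" using R2 G \<Phi>2 by auto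
      from left_mult_solutions[OF X X_inj this assms(22)]
      show "(K \<in> {K \<in> carrier_mat m p. K * ?X = - (R2 * ?G + \<Phi>2 * H1)}) =
        (K \<in> {- (R2 * ?G + \<Phi>2 * H1) * ?P + H2 * \<Psi> | H2. H2 \<in> carrier_mat m (dim_row \<Psi>)})"
        by simp
    qed
    also have "\<dots> \<longleftrightarrow> (\<exists>H1 \<in> carrier_mat d s. \<exists>H2 \<in> carrier_mat m (dim_row \<Psi>).
        K = - (R2 * ?G + \<Phi>2 * H1) * ?P + H2 * \<Psi>)"
      by blast
    also have "\<dots> \<longleftrightarrow> (\<exists>H1 \<in> carrier_mat d s. \<exists>H2 \<in> carrier_mat m (dim_row \<Psi>).
        K = - R2 * A * M * ?P - \<Phi>2 * H1 * ?P + H2 * \<Psi>)"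
      using formula by simp
    finally show ?thesis by blast
  qed
  thus ?thesis unfolding s d_def[symmetric] \<K>_def[symmetric] by blast
qed

end
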